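(* Let $p,q$ be positive integers, $n=p+q+1$ and $a>1$. Let $\mathcal{X}=\sum_{i=1}^{n}R_i\frac{\partial}{\partial x_i}$ be a degree two polynomial vector field on $S_{p,q}$, where for $i=1,\ldots,n$ $$R_i=\sum_{1\le j\le k\le n}\beta_{ijk}x_jx_k+\sum_{j=1}^n\beta_{ij}x_j+\beta_{i0},\qquad \beta_{ijk},\beta_{ij},\beta_{i0}\in\mathbb{R}.$$ Then the cofactor $K$ of $\mathcal{X}$ with respect to the defining polynomial of $S_{p,q}$ is $$K=\alpha_1x_1+\cdots+\alpha_nx_n\quad\text{with}\quad \alpha_1=\alpha_2=\cdots=\alpha_{p+1}=0,$$ that is, $K=\alpha_{p+2}x_{p+2}+\cdots+\alpha_nx_n$ for some $\alpha_{p+2},\ldots,\alpha_n\in\mathbb{R}$. Moreover, for all $i,j,k\in\{1,\ldots,p+1\}$ and $l,r,s\in\{p+2,\ldots,n\}$, all pairwise distinct, the following hold. The coefficients of the degree two terms satisfy $$\beta_{ijk}+\beta_{jik}+\beta_{kij}=0,\qquad \beta_{lrs}+\beta_{rls}+\beta_{slr}=0,$$ $$\beta_{ijl}+\beta_{jil}=0,\qquad \beta_{ljr}+\beta_{rjl}=0,$$ $$4(\beta_{ijj}+\beta_{jij})=\alpha_i,\qquad 2(\beta_{lrr}+\beta_{rlr})=\alpha_l,$$ $$4\beta_{iii}=\alpha_i,\qquad 2\beta_{lii}=-a^2\alpha_l,\qquad 2\beta_{lll}=\alpha_l.$$ The coefficients of the degree one terms satisfy $$\beta_{ij}+\beta_{ji}=0,\qquad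 \beta_{lr}+\beta_{rl}=0.$$ The constant terms satisfy $$\beta_{i0}=0,\qquad \beta_{l0}=\frac{a^4-1}{2}\,\alpha_l.$$
   Context: $S_{p,q}\subset\mathbb{R}^n$ is the hypersurface $\{h=0\}$, where $h=\left(\sum_{i=1}^{p+1}x_i^2-a^2\right)^2+\sum_{j=p+2}^{n}x_j^2-1$. A polynomial vector field $\mathcal{X}=\sum_iR_i\,\partial/\partial x_i$ on $\mathbb{R}^n$ has degree $\max_i\deg R_i$; it is a vector field on $S_{p,q}$ if $\mathcal{X}h=Kh$ for some $K\in\mathbb{R}[x_1,\ldots,x_n]$, and $K$ is then called the cofactor. In the relations, $\beta_{ijk}$ denotes the coefficient of the monomial $x_jx_k$ in $R_i$ irrespective of the order of the last two indices, so $\beta_{ijk}=\beta_{ikj}$. Each relation is asserted for those choices of the indices occurring in it that are pairwise distinct and lie in the stated ranges (a relation with no admissible choice is vacuous). *)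

theory Defs
  imports Complex_Main "HOL-Library.Poly_Mapping"
begin

text \<open>
  Real polynomials in the variables \<open>x\<^sub>0, x\<^sub>1, \<dots>\<close>: finitely supported maps from exponent
  vectors to coefficients, with the convolution product of \<open>HOL-Library.Poly_Mapping\<close>.
  The ring in \<open>x\<^sub>1, \<dots>, x\<^sub>n\<close> is the subset \<open>polys n\<close>.
\<close>

type_synonym rpoly = "(nat \<Rightarrow>\<^sub>0 nat) \<Rightarrow>\<^sub>0 real"

definition var :: "nat \<Rightarrow> rpoly" where
  "var i = Poly_Mapping.single (Poly_Mapping.single i 1) 1"

definition const :: "real \<Rightarrow> rpoly" where
  "const c = Poly_Mapping.single 0 c"

definition polys :: "nat \<Rightarrow> rpoly set" where
  "polys n = {P. \<forall>m \<in> Poly_Mapping.keys P. Poly_Mapping.keys m \<subseteq> {1..n}}"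

text \<open>Total degree; the zero polynomial gets degree \<open>0\<close>.\<close>

definition total_degree :: "rpoly \<Rightarrow> nat" where
  "total_degree P =
     Max (insert 0 ((\<lambda>m. \<Sum>i \<in> Poly_Mapping.keys m. Poly_Mapping.lookup m i) ` Poly_Mapping.keys P))"

text \<open>
  Exponent subtraction is pointwise and truncated; where it truncates,
  the coefficient is \<open>0\<close>.
\<close>

definition partial_deriv :: "nat \<Rightarrow> rpoly \<Rightarrow> rpoly" where
  "partial_deriv i P =
     (\<Sum>m \<in> Poly_Mapping.keys P.
        Poly_Mapping.single (m - Poly_Mapping.single i 1)
          (of_nat (Poly_Mapping.lookup m i) * Poly_Mapping.lookup P m))"

text \<open>
  A polynomial vector field \<open>\<Sum>\<^sub>i R\<^sub>i \<partial>/\<partial>x\<^sub>i\<close> on \<open>\<real>\<^sup>n\<close> is represented by its components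
  \<open>R 1, \<dots>, R n\<close>; the values of \<open>R\<close> outside \<open>{1..n}\<close> are irrelevant.
\<close>

definition vf_apply :: "nat \<Rightarrow> (nat \<Rightarrow> rpoly) \<Rightarrow> rpoly \<Rightarrow> rpoly" where
  "vf_apply n R f = (\<Sum>i = 1..n. R i * partial_deriv i f)"

definition vf_degree :: "nat \<Rightarrow> (nat \<Rightarrow> rpoly) \<Rightarrow> nat" where
  "vf_degree n R = Max ((\<lambda>i. total_degree (R i)) ` {1..n})"

text \<open>\<open>R\<close> is a polynomial vector field on the hypersurface \<open>{h = 0}\<close> of \<open>\<real>\<^sup>n\<close>, with cofactor \<open>K\<close>.\<close>

definition vector_field_on_with_cofactor ::
  "nat \<Rightarrow> rpoly \<Rightarrow> (nat \<Rightarrow> rpoly) \<Rightarrow> rpoly \<Rightarrow> bool" where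
  "vector_field_on_with_cofactor n h R K \<longleftrightarrow>
     (\<forall>i \<in> {1..n}. R i \<in> polys n) \<and> K \<in> polys n \<and> vf_apply n R h = K * h"

text \<open>The defining polynomial of \<open>S\<^sub>p\<^sub>,\<^sub>q\<close>, in \<open>n = p + q + 1\<close> variables.\<close>

definition S_poly :: "nat \<Rightarrow> nat \<Rightarrow> real \<Rightarrow> rpoly" where
  "S_poly p q a =
     ((\<Sum>i = 1..p+1. var i ^ 2) - const (a\<^sup>2)) ^ 2 + (\<Sum>j = p+2..p+q+1. var j ^ 2) - 1"

end

theory Submission
  imports Defs "HOL-Computational_Algebra.Polynomial"
begin

text \<open>
  Write \<open>s = \<Sum>\<^sub>i x\<^sub>i\<^sup>2\<close> and \<open>w = \<Sum>\<^sub>l x\<^sub>l\<^sup>2\<close> for the sums of squares over the first block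
  \<open>i \<le> p + 1\<close> and the second block \<open>l \<ge> p + 2\<close> of variables, and put \<open>A = \<Sum>\<^sub>i x\<^sub>i R\<^sub>i\<close>,
  \<open>B = \<Sum>\<^sub>l x\<^sub>l R\<^sub>l\<close>. The condition that the field is tangent to the hypersurface with cofactor \<open>K\<close> is

    \<open>4 (s - a\<^sup>2) A + 2 B = K ((s - a\<^sup>2)\<^sup>2 + w - 1)\<close>

  (\<open>vf_apply_S_poly\<close>). The left-hand side has degree at most \<open>5\<close> and the second factor on the right
  has degree \<open>4\<close> with top component \<open>s\<^sup>2 \<noteq> 0\<close>, so \<open>K = k0 + \<kappa>\<close> with \<open>k0\<close> constant and
  \<open>\<kappa> = \<Sum>\<^sub>i \<alpha>\<^sub>i x\<^sub>i\<close> (\<open>degree_cofactor_le_1\<close>). Let \<open>A0, A1, A2\<close> and \<open>B0, B1, B2\<close> be the parts of \<open>A\<close> and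
  \<open>B\<close> of degrees \<open>1, 2, 3\<close>, which come from the constant, linear and quadratic parts of the field.
  Comparing homogeneous components of degrees \<open>0, \<dots>, 5\<close> and using \<open>a\<^sup>4 \<noteq> 1\<close> gives \<open>k0 = 0\<close> and

    \<open>A1 = 0\<close>, \<open>4 A2 = \<kappa> s\<close>, \<open>B1 = 0\<close>, \<open>2 B0 - 4 a\<^sup>2 A0 = (a\<^sup>4 - 1) \<kappa>\<close>, \<open>4 s A0 + 2 B2 = \<kappa> (w - a\<^sup>2 s)\<close>

  (\<open>graded_identities\<close>). For \<open>i\<close> in the first block, the last two identities at the unit vector \<open>e\<^sub>i\<close>
  are two linear equations for \<open>\<alpha>\<^sub>i\<close> and \<open>\<beta>\<^sub>i\<^sub>0\<close>, which force \<open>\<alpha>\<^sub>i = \<beta>\<^sub>i\<^sub>0 = 0\<close>; hence \<open>A0 = 0\<close>. What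
  remains are identities between linear, quadratic and cubic forms, and the asserted relations are the
  equalities of their coefficients, which polarisation extracts (\<open>vanishing_quadratic_form\<close>,
  \<open>cubic_relations\<close>).

  Homogeneous components are handled by the substitution \<open>x\<^sub>i \<mapsto> t x\<^sub>i\<close> (\<open>dilate\<close>), which turns the
  comparison of degrees into one of univariate polynomials over an integral domain. The resulting
  identities are then evaluated at real points (\<open>eval_at\<close>).
\<close>

abbreviation lookup where "lookup \<equiv> Poly_Mapping.lookup"
abbreviation keys where "keys \<equiv> Poly_Mapping.keys"
abbreviation single where "single \<equiv> Poly_Mapping.single"

section \<open>Maps determined by their values on monomials\<close>

lemma poly_mapping_additive_induct [case_names single add]:
  fixes P :: "('k \<Rightarrow>\<^sub>0 'c::monoid_add) \<Rightarrow> bool"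
  assumes single: "\<And>m c. P (single m c)"
    and add: "\<And>f g. P f \<Longrightarrow> P g \<Longrightarrow> P (f + g)"
  shows "P f"
proof (induction f rule: Poly_Mapping.update_induct)
  case const
  show ?case using single[of undefined 0] by simp
next
  case (update f a b)
  have "Poly_Mapping.update a b f = f + single a b"
    using update.hyps
    by (intro poly_mapping_eqI) (auto simp: lookup_update lookup_add lookup_single in_keys_iff)
  then show ?case using add[OF update.IH single] by simp
qed

text \<open>
  Both the dilation and the evaluation below are of the form \<open>G\<close>. Products of sums distribute over
  the monomials, so multiplicativity need only be known for single monomials.
\<close>

lemma keys_sum_mult:
  fixes g :: "'k::monoid_add \<Rightarrow> 'c::semiring_0 \<Rightarrow> 'b::semiring_0"
  assumes zero: "\<And>m. g m 0 = 0"
    and add: "\<And>m c d. g m (c + d) = g m c + g m d"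
    and mult: "\<And>m m' c d. g (m + m') (c * d) = g m c * g m' d"
  defines "G \<equiv> \<lambda>P. \<Sum>m \<in> keys P. g m (lookup P m)"
  shows "G (P * Q) = G P * G Q"
proof -
  have G_add: "G (P + Q) = G P + G Q" for P Q
    unfolding G_def by (rule setsum_keys_plus_distrib) (simp_all add: zero add)
  have G_single: "G (single m c) = g m c" for m c
    by (simp add: G_def zero)
  show ?thesis
  proof (induction P rule: poly_mapping_additive_induct)
    case (single m c)
    show ?case
      by (induction Q rule: poly_mapping_additive_induct)
        (simp_all add: G_single G_add mult_single mult algebra_simps)
  qed (simp add: G_add algebra_simps)
qed

section \<open>Formal partial derivatives\<close>

lemma partial_deriv_single:
  "partial_deriv i (single m c) =
     single (m - single i 1) (of_nat (lookup m i) * c)"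
  by (simp add: partial_deriv_def)

lemma partial_deriv_add: "partial_deriv i (P + Q) = partial_deriv i P + partial_deriv i Q"
  unfolding partial_deriv_def
  by (rule setsum_keys_plus_distrib) (simp_all add: single_add algebra_simps)

lemma single_exponent_minus_add:
  fixes m m' :: "nat \<Rightarrow>\<^sub>0 nat"
  assumes "lookup m i \<noteq> 0"
  shows "(m + m') - single i 1 = (m - single i 1) + m'"
  using assms by (intro poly_mapping_eqI) (auto simp: lookup_add lookup_minus lookup_single when_def)

text \<open>
  The exponent subtraction truncates when \<open>x\<^sub>i\<close> does not occur, and then \<open>single_exponent_minus_add\<close>
  is not available. In that case the coefficient is \<open>0\<close>, so the exponent is immaterial.
\<close>

lemma partial_deriv_single_mult:
  "partial_deriv i (single m c * single m' d) =
     partial_deriv i (single m c) * single m' d + single m c * partial_deriv i (single m' d)"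
proof -
  have left: "single (m + m' - single i 1) (of_nat (lookup m i) * x) =
      single (m - single i 1 + m') (of_nat (lookup m i) * x)" for x :: real
    using single_exponent_minus_add[of m i m']
    by (cases "lookup m i = 0") simp_all
  have right: "single (m + m' - single i 1) (of_nat (lookup m' i) * x) =
      single (m + (m' - single i 1)) (of_nat (lookup m' i) * x)" for x :: real
    using single_exponent_minus_add[of m' i m]
    by (cases "lookup m' i = 0") (simp_all add: add.commute)
  have "partial_deriv i (single m c * single m' d) =
      single (m + m' - single i 1) (of_nat (lookup m i) * (c * d))
    + single (m + m' - single i 1) (of_nat (lookup m' i) * (c * d))"
    by (simp add: mult_single partial_deriv_single lookup_add algebra_simps flip: single_add)
  also have "\<dots> = partial_deriv i (single m c) * single m' d + single m c * partial_deriv i (single m' d)"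
    unfolding left right partial_deriv_single mult_single by (simp add: algebra_simps)
  finally show ?thesis .
qed

lemma partial_deriv_mult:
  "partial_deriv i (P * Q) = partial_deriv i P * Q + P * partial_deriv i Q"
proof (induction P rule: poly_mapping_additive_induct)
  case (single m c)
  show ?case
    by (induction Q rule: poly_mapping_additive_induct)
      (simp_all add: partial_deriv_single_mult partial_deriv_add algebra_simps)
qed (simp add: partial_deriv_add algebra_simps)

lemma partial_deriv_const: "partial_deriv i (const c) = 0"
  by (simp add: const_def partial_deriv_single)

lemma partial_deriv_var: "partial_deriv i (var j) = (if i = j then 1 else 0)"
  by (simp add: var_def partial_deriv_single lookup_single when_def)

lemma partial_deriv_diff: "partial_deriv i (P - Q) = partial_deriv i P - partial_deriv i Q"
  using partial_deriv_add[of i "P - Q" Q] by simp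

lemma partial_deriv_sum: "partial_deriv i (sum f A) = (\<Sum>j\<in>A. partial_deriv i (f j))"
proof (induction A rule: infinite_finite_induct)
qed (simp_all add: partial_deriv_add, simp_all add: partial_deriv_def)

lemma partial_deriv_sum_squares:
  assumes "finite A"
  shows "partial_deriv i (\<Sum>j\<in>A. var j ^ 2) = (if i \<in> A then 2 * var i else 0)"
proof -
  have "partial_deriv i (\<Sum>j\<in>A. var j ^ 2) = (\<Sum>j\<in>A. if j = i then 2 * var i else 0)"
    by (auto simp: partial_deriv_sum power2_eq_square partial_deriv_mult partial_deriv_var intro!: sum.cong)
  then show ?thesis using assms by (simp add: sum.delta)
qed

lemma partial_deriv_S_poly:
  "partial_deriv i (S_poly p q a) =
     (if i \<in> {1..p+1} then 4 * ((\<Sum>i = 1..p+1. var i ^ 2) - const (a\<^sup>2)) * var i else 0)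
     + (if i \<in> {p+2..p+q+1} then 2 * var i else 0)"
proof -
  have one: "partial_deriv i 1 = 0"
    using partial_deriv_const[of i 1] by (simp add: const_def)
  have square: "partial_deriv i (P ^ 2) = 2 * P * partial_deriv i P" for P
    by (simp add: power2_eq_square partial_deriv_mult algebra_simps)
  show ?thesis
    unfolding S_poly_def
    by (simp add: partial_deriv_add partial_deriv_diff one square partial_deriv_sum_squares
        partial_deriv_const algebra_simps del: sum.cl_ivl_Suc)
qed

section \<open>Grading by total degree: the dilation\<close>

definition weight :: "(nat \<Rightarrow>\<^sub>0 nat) \<Rightarrow> nat" where
  "weight m = (\<Sum>i \<in> keys m. lookup m i)"

text \<open>
  The ring homomorphism \<open>x\<^sub>i \<mapsto> t x\<^sub>i\<close> into the polynomials in a new variable \<open>t\<close>: the coefficient of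
  \<open>t\<^sup>d\<close> is the homogeneous component of degree \<open>d\<close>. Since the coefficient ring is an integral domain,
  degrees in \<open>t\<close> add up under multiplication, and homogeneous components can be compared
  by comparing coefficients in \<open>t\<close>.
\<close>

definition dilate :: "rpoly \<Rightarrow> rpoly poly" where
  "dilate P = (\<Sum>m \<in> keys P. monom (single m (lookup P m)) (weight m))"

lemma weight_add: "weight (m + m') = weight m + weight m'"
  unfolding weight_def by (rule setsum_keys_plus_distrib) simp_all

lemma dilate_single: "dilate (single m c) = monom (single m c) (weight m)"
  by (simp add: dilate_def)

lemma dilate_add: "dilate (P + Q) = dilate P + dilate Q"
  unfolding dilate_def
  by (rule setsum_keys_plus_distrib) (simp_all add: single_add add_monom)

lemma dilate_mult: "dilate (P * Q) = dilate P * dilate Q"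
  unfolding dilate_def
  by (rule keys_sum_mult) (simp_all add: single_add add_monom mult_monom mult_single weight_add)

lemma dilate_diff: "dilate (P - Q) = dilate P - dilate Q"
  using dilate_add[of "P - Q" Q] by simp

lemma dilate_const: "dilate (const c) = [:const c:]"
  by (simp add: const_def dilate_single weight_def monom_0)

lemma dilate_var: "dilate (var i) = [:0, var i:]"
  by (simp add: var_def dilate_single weight_def monom_Suc monom_0)

lemma dilate_sum: "dilate (sum f A) = (\<Sum>j\<in>A. dilate (f j))"
proof (induction A rule: infinite_finite_induct)
qed (simp_all add: dilate_add, simp_all add: dilate_def)

lemma lookup_coeff_dilate:
  "lookup (coeff (dilate P) d) m = (if weight m = d then lookup P m else 0)"
proof (induction P rule: poly_mapping_additive_induct)
  case (single m' c)
  show ?case by (auto simp: dilate_single lookup_single when_def)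
qed (simp add: dilate_add lookup_add)

text \<open>
  A monomial of total degree \<open>d\<close> survives in the coefficient of \<open>t\<^sup>d\<close>, so only the monomials \<open>1\<close> and
  \<open>x\<^sub>1, \<dots>, x\<^sub>n\<close> can occur in \<open>P\<close>.
\<close>

lemma affine_if_degree_dilate_le_1:
  assumes "degree (dilate P) \<le> 1" "P \<in> polys n"
  shows "P = const (lookup P 0) + (\<Sum>i = 1..n. const (lookup P (single i 1)) * var i)"
proof (rule poly_mapping_eqI)
  fix m
  have var: "const c * var i = single (single i 1) c" for c i
    by (simp add: const_def var_def mult_single)
  have const: "lookup (const c) m = (if m = 0 then c else 0)" for c m
    by (simp add: const_def lookup_single when_def)
  show "lookup P m = lookup (const (lookup P 0) + (\<Sum>i = 1..n. const (lookup P (single i 1)) * var i)) m"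
  proof (cases "lookup P m = 0")
    case True
    then show ?thesis
      by (auto simp: lookup_add lookup_sum var const lookup_single when_def intro!: sum.neutral)
  next
    case False
    have "\<not> degree (dilate P) < weight m"
    proof
      assume "degree (dilate P) < weight m"
      then have "coeff (dilate P) (weight m) = 0" by (rule coeff_eq_0)
      then have "lookup (coeff (dilate P) (weight m)) m = 0" by simp
      then show False using False by (simp add: lookup_coeff_dilate)
    qed
    with assms(1) have w: "weight m \<le> 1" by simp
    have sub: "keys m \<subseteq> {1..n}"
      using assms(2) False by (auto simp: polys_def in_keys_iff)
    show ?thesis
    proof (cases "m = 0")
      case True
      have "single i (1::nat) \<noteq> 0" for i :: nat
        by (metis keys_single keys_zero insert_not_empty zero_neq_one)
      then show ?thesis
        using True by (simp add: lookup_add lookup_sum var const lookup_single when_def)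
    next
      case False
      then obtain i where i: "i \<in> keys m" by (metis keys_eq_empty ex_in_conv)
      have "weight m = lookup m i + (\<Sum>j \<in> keys m - {i}. lookup m j)"
        unfolding weight_def using i by (simp add: sum.remove)
      moreover have "lookup m i \<ge> 1" using i by (simp add: in_keys_iff)
      ultimately have mi: "lookup m i = 1" and rest: "(\<Sum>j \<in> keys m - {i}. lookup m j) = 0"
        using w by linarith+
      have m: "m = single i 1"
        using mi rest by (intro poly_mapping_eqI) (auto simp: lookup_single when_def in_keys_iff)
      have inj: "single j (1::nat) = single i 1 \<longleftrightarrow> j = i" for j :: nat
        by (metis keys_single insertI1 singletonD zero_neq_one)
      show ?thesis using i sub False unfolding m
        by (simp add: lookup_add lookup_sum var const lookup_single inj[unfolded One_nat_def] when_def)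
    qed
  qed
qed

section \<open>Evaluation at real points\<close>

text \<open>
  The product runs over the fixed set of indices \<open>1, \<dots>, n\<close> rather than over the variables of the
  monomial; this makes multiplicativity immediate, and a polynomial in \<open>polys n\<close> has no other variables.
\<close>

definition eval_at :: "nat \<Rightarrow> (nat \<Rightarrow> real) \<Rightarrow> rpoly \<Rightarrow> real" where
  "eval_at n v P = (\<Sum>m \<in> keys P. lookup P m * (\<Prod>i = 1..n. v i ^ lookup m i))"

lemma eval_at_add: "eval_at n v (P + Q) = eval_at n v P + eval_at n v Q"
  unfolding eval_at_def by (rule setsum_keys_plus_distrib) (simp_all add: algebra_simps)

lemma eval_at_mult: "eval_at n v (P * Q) = eval_at n v P * eval_at n v Q"
  unfolding eval_at_def
  by (rule keys_sum_mult)
     (simp_all add: algebra_simps lookup_add power_add prod.distrib)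

lemma eval_at_diff: "eval_at n v (P - Q) = eval_at n v P - eval_at n v Q"
  using eval_at_add[of n v "P - Q" Q] by simp

lemma eval_at_const: "eval_at n v (const c) = c"
  by (simp add: const_def eval_at_def)

lemma eval_at_var: "i \<in> {1..n} \<Longrightarrow> eval_at n v (var i) = v i"
  by (simp add: var_def eval_at_def lookup_single when_def if_distrib[of "\<lambda>k. _ ^ k"] prod.delta
      cong: if_cong)

lemma eval_at_sum: "eval_at n v (sum f A) = (\<Sum>j\<in>A. eval_at n v (f j))"
proof (induction A rule: infinite_finite_induct)
qed (simp_all add: eval_at_add, simp_all add: eval_at_def)

section \<open>Coefficients of vanishing forms\<close>

lemma sum_mult_unit_vector:
  fixes f :: "'i \<Rightarrow> real"
  assumes "finite N" "k \<in> N"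
  shows "(\<Sum>l\<in>N. f l * of_bool (l = k)) = f k"
  using assms by (simp add: of_bool_def if_distrib[of "\<lambda>x. _ * x"] cong: if_cong)

lemma vanishing_linear_form:
  fixes T :: "nat \<Rightarrow> real"
  assumes "finite N" "\<And>v. (\<Sum>i\<in>N. T i * v i) = 0" "i \<in> N"
  shows "T i = 0"
  using assms(2)[of "\<lambda>j. of_bool (j = i)"] assms(1,3) by (simp add: sum_mult_unit_vector)

text \<open>
  Polarisation: if \<open>M\<close> is the bilinear form with matrix \<open>T\<close>, then
  \<open>T i j + T j i = M(e\<^sub>i + e\<^sub>j, e\<^sub>i + e\<^sub>j) - M(e\<^sub>i, e\<^sub>i) - M(e\<^sub>j, e\<^sub>j)\<close>. The indices may coincide.
\<close>

lemma vanishing_quadratic_form: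
  fixes T :: "nat \<Rightarrow> nat \<Rightarrow> real"
  assumes "finite N" "\<And>v. (\<Sum>i\<in>N. \<Sum>j\<in>N. T i j * v i * v j) = 0" "i \<in> N" "j \<in> N"
  shows "T i j + T j i = 0"
proof -
  define M where "M u v = (\<Sum>i\<in>N. \<Sum>j\<in>N. T i j * u i * v j)" for u v :: "nat \<Rightarrow> real"
  define e where "e k = (\<lambda>l. of_bool (l = k) :: real)" for k :: nat
  have M0: "M v v = 0" for v using assms(2) by (simp add: M_def)
  have add1: "M (\<lambda>l. u l + u' l) v = M u v + M u' v" for u u' v
    by (simp add: M_def algebra_simps sum.distrib)
  have add2: "M u (\<lambda>l. v l + v' l) = M u v + M u v'" for u v v'
    by (simp add: M_def algebra_simps sum.distrib)
  have M_e: "M (e k) (e l) = T k l" if "k \<in> N" "l \<in> N" for k l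
    unfolding M_def e_def sum_mult_unit_vector[OF assms(1) that(2)]
    by (rule sum_mult_unit_vector[OF assms(1) that(1)])
  show ?thesis
    using M0[of "\<lambda>l. e i l + e j l"] M0[of "e i"] M0[of "e j"]
    by (simp add: add1 add2 M_e assms)
qed

text \<open>
  Polarisation again: the sum over all permutations of the indices is the alternating sum of the
  values of the form at the partial sums of \<open>e\<^sub>i, e\<^sub>j, e\<^sub>k\<close>. Because coinciding indices are admitted,
  this one relation yields the coefficients of \<open>x\<^sub>i x\<^sub>j x\<^sub>k\<close>, of \<open>x\<^sub>i x\<^sub>j\<^sup>2\<close> and of \<open>x\<^sub>i\<^sup>3\<close>.
\<close>

lemma vanishing_cubic_form:
  fixes T :: "nat \<Rightarrow> nat \<Rightarrow> nat \<Rightarrow> real"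
  assumes "finite N" "\<And>v. (\<Sum>i\<in>N. \<Sum>j\<in>N. \<Sum>k\<in>N. T i j k * v i * v j * v k) = 0"
    and "i \<in> N" "j \<in> N" "k \<in> N"
  shows "T i j k + T i k j + T j i k + T j k i + T k i j + T k j i = 0"
proof -
  define M where "M u v w = (\<Sum>i\<in>N. \<Sum>j\<in>N. \<Sum>k\<in>N. T i j k * u i * v j * w k)"
    for u v w :: "nat \<Rightarrow> real"
  define e where "e k = (\<lambda>l. of_bool (l = k) :: real)" for k :: nat
  have M0: "M v v v = 0" for v using assms(2) by (simp add: M_def)
  have add1: "M (\<lambda>l. u l + u' l) v w = M u v w + M u' v w" for u u' v w
    by (simp add: M_def algebra_simps sum.distrib)
  have add2: "M u (\<lambda>l. v l + v' l) w = M u v w + M u v' w" for u v v' w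
    by (simp add: M_def algebra_simps sum.distrib)
  have add3: "M u v (\<lambda>l. w l + w' l) = M u v w + M u v w'" for u v w w'
    by (simp add: M_def algebra_simps sum.distrib)
  have M_e: "M (e i) (e j) (e k) = T i j k" if "i \<in> N" "j \<in> N" "k \<in> N" for i j k
    unfolding M_def e_def sum_mult_unit_vector[OF assms(1) that(3)]
      sum_mult_unit_vector[OF assms(1) that(2)]
    by (rule sum_mult_unit_vector[OF assms(1) that(1)])
  show ?thesis
    using M0[of "\<lambda>l. (e i l + e j l) + e k l"]
      M0[of "\<lambda>l. e i l + e j l"] M0[of "\<lambda>l. e i l + e k l"] M0[of "\<lambda>l. e j l + e k l"]
      M0[of "e i"] M0[of "e j"] M0[of "e k"]
    by (simp add: add1 add2 add3 M_e assms)
qed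

text \<open>
  Passes from a quadratic form written with one coefficient for each monomial to one with a square
  coefficient matrix, as needed for polarisation.
\<close>

lemma sum_upper_triangle:
  fixes f g :: "nat \<Rightarrow> nat \<Rightarrow> real"
  assumes "\<And>j k. 1 \<le> j \<Longrightarrow> j < k \<Longrightarrow> k \<le> n \<Longrightarrow> g j k + g k j = f j k"
    and "\<And>j. 1 \<le> j \<Longrightarrow> j \<le> n \<Longrightarrow> g j j = f j j"
  shows "(\<Sum>j = 1..n. \<Sum>k = j..n. f j k) = (\<Sum>j = 1..n. \<Sum>k = 1..n. g j k)"
  using assms
proof (induction n)
  case (Suc n)
  have "(\<Sum>j = 1..Suc n. \<Sum>k = j..Suc n. f j k)
      = (\<Sum>j = 1..n. \<Sum>k = j..n. f j k) + (\<Sum>j = 1..n. f j (Suc n)) + f (Suc n) (Suc n)"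
    by (simp add: sum.distrib)
  also have "(\<Sum>j = 1..n. \<Sum>k = j..n. f j k) = (\<Sum>j = 1..n. \<Sum>k = 1..n. g j k)"
    using Suc.prems by (intro Suc.IH) auto
  also have "(\<Sum>j = 1..n. f j (Suc n)) = (\<Sum>j = 1..n. g j (Suc n)) + (\<Sum>j = 1..n. g (Suc n) j)"
    using Suc.prems(1) by (auto simp flip: sum.distrib intro!: sum.cong)
  also have "f (Suc n) (Suc n) = g (Suc n) (Suc n)"
    using Suc.prems(2) by simp
  finally show ?case by (simp add: sum.distrib)
qed simp

text \<open>
  The shape shared by the two cubic identities of a vector field on the hypersurface: a sum of
  coordinates times quadratic forms equals a linear form times a diagonal quadratic form. The
  symmetry of \<open>G\<close> halves the six permutations of polarisation to three.
\<close>

lemma cubic_relations: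
  fixes c b d :: "nat \<Rightarrow> real" and G :: "nat \<Rightarrow> nat \<Rightarrow> nat \<Rightarrow> real"
  assumes fin: "finite N"
    and identity: "\<And>v. (\<Sum>i\<in>N. c i * v i * (\<Sum>j\<in>N. \<Sum>k\<in>N. G i j k * v j * v k))
                     = (\<Sum>i\<in>N. b i * v i) * (\<Sum>j\<in>N. d j * v j ^ 2)"
    and sym: "\<And>i j k. i \<in> N \<Longrightarrow> j \<in> N \<Longrightarrow> k \<in> N \<Longrightarrow> G i j k = G i k j"
    and ijk: "i \<in> N" "j \<in> N" "k \<in> N"
  shows "c i * G i j k + c j * G j i k + c k * G k i j
       = b i * (d j * of_bool (k = j)) + b j * (d i * of_bool (k = i)) + b k * (d i * of_bool (j = i))"
proof -
  define T where "T i j k = c i * G i j k - b i * (d j * of_bool (k = j))" for i j k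
  have "(\<Sum>i\<in>N. \<Sum>j\<in>N. \<Sum>k\<in>N. T i j k * v i * v j * v k) = 0" for v
  proof -
    have cubic: "(\<Sum>i\<in>N. c i * v i * (\<Sum>j\<in>N. \<Sum>k\<in>N. G i j k * v j * v k))
        = (\<Sum>i\<in>N. \<Sum>j\<in>N. \<Sum>k\<in>N. c i * G i j k * v i * v j * v k)"
      by (simp add: sum_distrib_left mult_ac)
    have "(\<Sum>j\<in>N. d j * v j ^ 2) = (\<Sum>j\<in>N. \<Sum>k\<in>N. d j * v j * v k * of_bool (k = j))"
      using fin by (intro sum.cong refl)
        (simp add: sum_mult_unit_vector[of N _ "\<lambda>k. d _ * v _ * v k"] power2_eq_square)
    then have "(\<Sum>i\<in>N. b i * v i) * (\<Sum>j\<in>N. d j * v j ^ 2)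
        = (\<Sum>i\<in>N. \<Sum>j\<in>N. \<Sum>k\<in>N. b i * (d j * of_bool (k = j)) * v i * v j * v k)"
      by (simp add: sum_product) (simp add: sum_distrib_left mult_ac)
    with cubic identity[of v] show ?thesis
      by (simp add: T_def left_diff_distrib sum_subtractf)
  qed
  from vanishing_cubic_form[OF fin this ijk]
  have "T i j k + T i k j + T j i k + T j k i + T k i j + T k j i = 0" .
  moreover have "d k * of_bool (j = k) = d j * of_bool (k = j)"
    and "d k * of_bool (i = k) = d i * of_bool (k = i)"
    and "d j * of_bool (i = j) = d i * of_bool (j = i)"
    by auto
  moreover have "G i k j = G i j k" "G j k i = G j i k" "G k j i = G k i j"
    using sym ijk by simp_all
  ultimately show ?thesis
    by (simp only: T_def)
qed

section \<open>The tangency condition by degrees\<close>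

lemma vf_apply_S_poly:
  assumes "n = p + q + 1"
  shows "vf_apply n R (S_poly p q a) =
      4 * ((\<Sum>i = 1..p+1. var i ^ 2) - const (a\<^sup>2)) * (\<Sum>i = 1..p+1. var i * R i)
    + 2 * (\<Sum>l = p+2..n. var l * R l)"
proof -
  define u where "u = 4 * ((\<Sum>i = 1..p+1. var i ^ 2) - const (a\<^sup>2))"
  have split: "{1..n} = {1..p+1} \<union> {p+2..n}" "{1..p+1} \<inter> {p+2..n} = {}"
    using assms by auto
  have "vf_apply n R (S_poly p q a) =
      (\<Sum>i \<in> {1..p+1} \<union> {p+2..n}. R i * ((if i \<in> {1..p+1} then u * var i else 0)
         + (if i \<in> {p+2..n} then 2 * var i else 0)))"
    unfolding vf_apply_def partial_deriv_S_poly split(1)[symmetric] u_def assms[symmetric] ..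
  also have "\<dots> = (\<Sum>i = 1..p+1. R i * (u * var i)) + (\<Sum>l = p+2..n. R l * (2 * var l))"
    by (subst sum.union_disjoint) (auto simp: split(2) intro!: sum.cong)
  finally show ?thesis
    unfolding u_def[symmetric] by (simp only: sum_distrib_left mult_ac)
qed

lemma sum_pCons: "(\<Sum>i\<in>A. pCons (f i) (P i)) = pCons (\<Sum>i\<in>A. f i) (\<Sum>i\<in>A. P i)"
  by (induction A rule: infinite_finite_induct) simp_all

lemma dilate_S_poly:
  fixes p q :: nat and a :: real
  defines "s \<equiv> \<Sum>i = 1..p+1. var i ^ 2" and "w \<equiv> \<Sum>l = p+2..p+q+1. var l ^ 2"
    and "c \<equiv> const (a\<^sup>2)"
  shows "dilate (S_poly p q a) = [:c^2 - 1, 0, w - 2 * c * s, 0, s^2:]"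
proof -
  have squares: "dilate (\<Sum>i\<in>I. var i ^ 2) = [:0, 0, \<Sum>i\<in>I. var i ^ 2:]" for I
    by (simp add: dilate_sum power2_eq_square dilate_mult dilate_var sum_pCons)
  have one: "dilate 1 = 1"
    using dilate_const[of 1] by (simp add: const_def)
  have "dilate (S_poly p q a) = ([:0, 0, s:] - [:c:])^2 + [:0, 0, w:] - 1"
    unfolding S_poly_def s_def w_def c_def power2_eq_square[of "_ - _"]
    by (simp only: dilate_add dilate_diff dilate_mult squares dilate_const one)
  also have "\<dots> = [:c^2 - 1, 0, w - 2 * c * s, 0, s^2:]"
    by (simp add: power2_eq_square one_pCons algebra_simps)
  finally show ?thesis .
qed

text \<open>
  The left-hand side has degree at most \<open>5\<close> in \<open>t\<close>. As \<open>s\<^sup>2 \<noteq> 0\<close>, the second factor on the right has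
  degree exactly \<open>4\<close>, and degrees add up in an integral domain.
\<close>

lemma degree_cofactor_le_1:
  fixes k :: "'r::idom poly"
  assumes "4 * [:-c, 0, s:] * [:0, A0, A1, A2:] + 2 * [:0, B0, B1, B2:] = k * [:e, 0, f, 0, s^2:]"
    and "s \<noteq> 0"
  shows "degree k \<le> 1"
proof (cases "k = 0")
  case False
  have "degree (4 * [:-c, 0, s:] * [:0, A0, A1, A2:] + 2 * [:0, B0, B1, B2:])
      \<le> degree [:0, 2 * B0 - 4 * c * A0, 2 * B1 - 4 * c * A1, 4 * s * A0 - 4 * c * A2 + 2 * B2, 4 * s * A1, 4 * s * A2:]"
    by (simp add: numeral_poly algebra_simps)
  also have "\<dots> \<le> 5" by (simp add: degree_pCons_le)
  finally have "degree (k * [:e, 0, f, 0, s^2:]) \<le> 5" unfolding assms(1) .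
  moreover have "degree (k * [:e, 0, f, 0, s^2:]) = degree k + 4"
    using False \<open>s \<noteq> 0\<close> by (subst degree_mult_eq) auto
  ultimately show ?thesis by simp
qed simp

text \<open>
  Here \<open>t\<^sup>0\<close> gives \<open>k0 = 0\<close>. Then \<open>t\<^sup>4\<close> and \<open>t\<^sup>5\<close>, after cancelling \<open>s\<close>, determine \<open>A1\<close> and \<open>A2\<close>;
  inserting these into \<open>t\<^sup>2\<close> and \<open>t\<^sup>3\<close> gives the statements on \<open>B1\<close> and \<open>B2\<close>, and \<open>t\<^sup>1\<close> relates
  \<open>A0\<close> and \<open>B0\<close>. Factors such as \<open>4\<close> and \<open>2\<close> are kept because the ring
  may have positive characteristic.
\<close>

lemma graded_identities:
  fixes s :: "'r::idom"
  assumes "4 * [:-c, 0, s:] * [:0, A0, A1, A2:] + 2 * [:0, B0, B1, B2:]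
      = [:k0, k1:] * [:c^2 - 1, 0, w - 2 * c * s, 0, s^2:]"
    and "s \<noteq> 0" and "c^2 \<noteq> 1"
  shows "k0 = 0" "4 * A1 = 0" "4 * A2 = k1 * s" "2 * B1 = 0"
    and "2 * B0 - 4 * c * A0 = k1 * (c^2 - 1)"
    and "4 * s * A0 + 2 * B2 = k1 * (w - c * s)"
proof -
  have "[:0, 2 * B0 - 4 * c * A0, 2 * B1 - 4 * c * A1, 4 * s * A0 - 4 * c * A2 + 2 * B2, 4 * s * A1, 4 * s * A2:]
    = [:k0 * (c^2 - 1), k1 * (c^2 - 1), k0 * (w - 2 * c * s), k1 * (w - 2 * c * s), k0 * s^2, k1 * s^2:]"
    using assms(1) by (simp add: numeral_poly algebra_simps)
  then have eqs: "k0 * (c^2 - 1) = 0" "2 * B0 - 4 * c * A0 = k1 * (c^2 - 1)"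
      "2 * B1 - 4 * c * A1 = k0 * (w - 2 * c * s)"
      "4 * s * A0 - 4 * c * A2 + 2 * B2 = k1 * (w - 2 * c * s)"
      "4 * s * A1 = k0 * s^2" "4 * s * A2 = k1 * s^2"
    by (simp_all only: pCons_eq_iff simp_thms)
  show k0: "k0 = 0" using eqs(1) assms(3) by simp
  have "s * (4 * A1) = 0" using eqs(5) k0 by (simp add: algebra_simps)
  then show A1: "4 * A1 = 0" using assms(2) by (simp del: mult_eq_0_iff add: mult_eq_0_iff[of s])
  have "s * (4 * A2) = s * (k1 * s)" using eqs(6) by (simp add: algebra_simps power2_eq_square)
  then show A2: "4 * A2 = k1 * s" using assms(2) by (simp only: mult_cancel_left simp_thms)
  show "2 * B0 - 4 * c * A0 = k1 * (c^2 - 1)" by (fact eqs(2))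
  have "2 * B1 = k0 * (w - 2 * c * s) + c * (4 * A1)" using eqs(3) by (simp add: algebra_simps)
  then show "2 * B1 = 0" using k0 A1 by simp
  have "4 * s * A0 + 2 * B2 = k1 * (w - 2 * c * s) + c * (4 * A2)"
    using eqs(4) by (simp add: algebra_simps)
  then show "4 * s * A0 + 2 * B2 = k1 * (w - c * s)"
    unfolding A2 by (simp add: algebra_simps)
qed
section \<open>Vector fields of degree two\<close>

theorem proposition3p4:
  fixes p q n :: nat and a :: real
    and R :: "nat \<Rightarrow> rpoly" and K :: rpoly
    and \<beta>2 :: "nat \<Rightarrow> nat \<Rightarrow> nat \<Rightarrow> real"
    and \<beta>1 :: "nat \<Rightarrow> nat \<Rightarrow> real"
    and \<beta>0 :: "nat \<Rightarrow> real"
  assumes "p \<ge> 1" and "q \<ge> 1" and "n = p + q + 1" and "a > 1"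
    and R: "\<And>i. i \<in> {1..n} \<Longrightarrow>
          R i = (\<Sum>j = 1..n. \<Sum>k = j..n. const (\<beta>2 i j k) * var j * var k)
              + (\<Sum>j = 1..n. const (\<beta>1 i j) * var j) + const (\<beta>0 i)"
    and sym: "\<And>i j k. i \<in> {1..n} \<Longrightarrow> j \<in> {1..n} \<Longrightarrow> k \<in> {1..n} \<Longrightarrow> \<beta>2 i j k = \<beta>2 i k j"
    and "vf_degree n R = 2"
    and "vector_field_on_with_cofactor n (S_poly p q a) R K"
  shows "\<exists>\<alpha> :: nat \<Rightarrow> real.
      K = (\<Sum>i = 1..n. const (\<alpha> i) * var i)
    \<and> (\<forall>i \<in> {1..p+1}. \<alpha> i = 0)
    \<and> K = (\<Sum>l = p+2..n. const (\<alpha> l) * var l)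
    \<and> (\<forall>i \<in> {1..p+1}. \<forall>j \<in> {1..p+1}. \<forall>k \<in> {1..p+1}. distinct [i, j, k] \<longrightarrow>
          \<beta>2 i j k + \<beta>2 j i k + \<beta>2 k i j = 0)
    \<and> (\<forall>l \<in> {p+2..n}. \<forall>r \<in> {p+2..n}. \<forall>s \<in> {p+2..n}. distinct [l, r, s] \<longrightarrow>
          \<beta>2 l r s + \<beta>2 r l s + \<beta>2 s l r = 0)
    \<and> (\<forall>i \<in> {1..p+1}. \<forall>j \<in> {1..p+1}. \<forall>l \<in> {p+2..n}. i \<noteq> j \<longrightarrow>
          \<beta>2 i j l + \<beta>2 j i l = 0)
    \<and> (\<forall>j \<in> {1..p+1}. \<forall>l \<in> {p+2..n}. \<forall>r \<in> {p+2..n}. l \<noteq> r \<longrightarrow>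
          \<beta>2 l j r + \<beta>2 r j l = 0)
    \<and> (\<forall>i \<in> {1..p+1}. \<forall>j \<in> {1..p+1}. i \<noteq> j \<longrightarrow>
          4 * (\<beta>2 i j j + \<beta>2 j i j) = \<alpha> i)
    \<and> (\<forall>l \<in> {p+2..n}. \<forall>r \<in> {p+2..n}. l \<noteq> r \<longrightarrow>
          2 * (\<beta>2 l r r + \<beta>2 r l r) = \<alpha> l)
    \<and> (\<forall>i \<in> {1..p+1}. 4 * \<beta>2 i i i = \<alpha> i)
    \<and> (\<forall>i \<in> {1..p+1}. \<forall>l \<in> {p+2..n}. 2 * \<beta>2 l i i = - (a\<^sup>2) * \<alpha> l)
    \<and> (\<forall>l \<in> {p+2..n}. 2 * \<beta>2 l l l = \<alpha> l)
    \<and> (\<forall>i \<in> {1..p+1}. \<forall>j \<in> {1..p+1}. i \<noteq> j \<longrightarrow> \<beta>1 i j + \<beta>1 j i = 0)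
    \<and> (\<forall>l \<in> {p+2..n}. \<forall>r \<in> {p+2..n}. l \<noteq> r \<longrightarrow> \<beta>1 l r + \<beta>1 r l = 0)
    \<and> (\<forall>i \<in> {1..p+1}. \<beta>0 i = 0)
    \<and> (\<forall>l \<in> {p+2..n}. \<beta>0 l = (a ^ 4 - 1) / 2 * \<alpha> l)"
proof -
  define X where "X = {1..p+1}"
  define Y where "Y = {p+2..n}"
  define N where "N = {1..n}"
  have fin: "finite N" "finite X" "finite Y"
    and XY: "N = X \<union> Y" "X \<inter> Y = {}"
    using \<open>n = p + q + 1\<close> by (auto simp: N_def X_def Y_def)
  have K_polys: "K \<in> polys n" and cofactor: "vf_apply n R (S_poly p q a) = K * S_poly p q a"
    using \<open>vector_field_on_with_cofactor n (S_poly p q a) R K\<close>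
    by (simp_all add: vector_field_on_with_cofactor_def)

  define s where "s = (\<Sum>i\<in>X. var i ^ 2)"
  define w where "w = (\<Sum>l\<in>Y. var l ^ 2)"
  define c where "c = const (a\<^sup>2)"
  define r1 where "r1 i = (\<Sum>j\<in>N. const (\<beta>1 i j) * var j)" for i
  define r2 where "r2 i = (\<Sum>j = 1..n. \<Sum>k = j..n. const (\<beta>2 i j k) * var j * var k)" for i
  \<comment> \<open>Applied to the constant, linear or quadratic parts of the components \<open>R i\<close>, \<open>F X\<close> and \<open>F Y\<close>
    give the parts of \<open>A\<close> and \<open>B\<close> of degree one, two or three.\<close>
  define F where "F I f = (\<Sum>i\<in>I. var i * f i)" for I :: "nat set" and f :: "nat \<Rightarrow> rpoly"

  have dilate_R: "dilate (R i) = [:const (\<beta>0 i), r1 i, r2 i:]" if "i \<in> N" for i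
    using R[of i] that unfolding r1_def r2_def N_def
    by (simp add: dilate_add dilate_sum dilate_mult dilate_const dilate_var sum_pCons mult_ac)
  have dilate_F: "dilate (\<Sum>i\<in>I. var i * R i) = [:0, F I (\<lambda>i. const (\<beta>0 i)), F I r1, F I r2:]"
    if "I \<subseteq> N" for I
  proof -
    have "dilate (\<Sum>i\<in>I. var i * R i)
        = (\<Sum>i\<in>I. [:0, var i * const (\<beta>0 i), var i * r1 i, var i * r2 i:])"
      using that by (auto simp: dilate_sum dilate_mult dilate_var dilate_R subset_iff intro!: sum.cong)
    then show ?thesis by (simp add: sum_pCons F_def)
  qed
  have four: "dilate 4 = 4" and two: "dilate 2 = 2"
    using dilate_const[of 4] dilate_const[of 2]
    by (simp_all add: const_def numeral_poly)
  have dilate_s: "dilate s = [:0, 0, s:]"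
    by (simp add: s_def dilate_sum power2_eq_square dilate_mult dilate_var sum_pCons)
  have dilated: "4 * [:-c, 0, s:] * [:0, F X (\<lambda>i. const (\<beta>0 i)), F X r1, F X r2:]
      + 2 * [:0, F Y (\<lambda>i. const (\<beta>0 i)), F Y r1, F Y r2:]
      = dilate K * [:c^2 - 1, 0, w - 2 * c * s, 0, s^2:]"
  proof -
    have "dilate (vf_apply n R (S_poly p q a))
        = 4 * (dilate s - dilate c) * dilate (\<Sum>i\<in>X. var i * R i) + 2 * dilate (\<Sum>l\<in>Y. var l * R l)"
      unfolding vf_apply_S_poly[OF \<open>n = p + q + 1\<close>] s_def c_def X_def Y_def
      by (simp only: dilate_add dilate_mult dilate_diff four two)
    moreover have "dilate s - dilate c = [:-c, 0, s:]"
      by (simp add: dilate_s c_def dilate_const)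
    moreover have "dilate (S_poly p q a) = [:c^2 - 1, 0, w - 2 * c * s, 0, s^2:]"
      using dilate_S_poly[of p q a] \<open>n = p + q + 1\<close>
      by (simp only: s_def w_def c_def X_def Y_def)
    ultimately show ?thesis
      using cofactor dilate_F[of X] dilate_F[of Y] XY(1) by (simp only: dilate_mult) simp
  qed

  have eval_F: "eval_at n v (F I f) = (\<Sum>i\<in>I. v i * eval_at n v (f i))" if "I \<subseteq> N" for I f v
    using that by (auto simp: F_def eval_at_sum eval_at_mult eval_at_var subset_iff N_def intro!: sum.cong)
  have eval_squares: "eval_at n v (\<Sum>i\<in>I. var i ^ 2) = (\<Sum>i\<in>I. v i ^ 2)" if "I \<subseteq> N" for I v
    using that by (auto simp: eval_at_sum power2_eq_square eval_at_mult eval_at_var subset_iff N_def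
        intro!: sum.cong)
  have "s \<noteq> 0"
  proof
    assume "s = 0"
    then have "eval_at n (\<lambda>_. 1) s = 0" by (simp add: eval_at_def)
    moreover have "eval_at n (\<lambda>_. 1) s = card X"
      using XY(1) by (simp add: s_def eval_squares)
    ultimately show False by (simp add: X_def)
  qed
  have "a ^ 4 > 1" using \<open>a > 1\<close> by (intro one_less_power) auto
  have c2: "c ^ 2 = const (a ^ 4)"
    by (simp add: c_def const_def mult_single power2_eq_square power4_eq_xxxx mult.assoc)
  have "c ^ 2 \<noteq> 1"
  proof
    assume "c ^ 2 = 1"
    then have "eval_at n (\<lambda>_. 0) (const (a ^ 4)) = eval_at n (\<lambda>_. 0) (const 1)"
      unfolding c2 by (simp add: const_def)
    then show False using \<open>a ^ 4 > 1\<close> by (simp add: eval_at_const)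
  qed

  \<comment> \<open>The cofactor is affine because its dilation has degree at most \<open>1\<close>. Once it is written as
    \<open>k0 + \<kappa>\<close>, the homogeneous components of the defining identity become available.\<close>
  define \<alpha> where "\<alpha> i = Poly_Mapping.lookup K (Poly_Mapping.single i 1)" for i
  define \<kappa> where "\<kappa> = (\<Sum>i\<in>N. const (\<alpha> i) * var i)"
  define k0 where "k0 = const (Poly_Mapping.lookup K 0)"
  have K: "K = k0 + \<kappa>"
    using affine_if_degree_dilate_le_1[OF degree_cofactor_le_1[OF dilated \<open>s \<noteq> 0\<close>] K_polys]
    by (simp only: k0_def \<kappa>_def \<alpha>_def N_def)
  have dilate_K: "dilate K = [:k0, \<kappa>:]"
    unfolding K by (simp add: \<kappa>_def k0_def dilate_add dilate_sum dilate_mult dilate_const dilate_var sum_pCons mult.commute)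
  note graded = graded_identities[OF dilated[unfolded dilate_K] \<open>s \<noteq> 0\<close> \<open>c ^ 2 \<noteq> 1\<close>]
  have K_linear: "K = \<kappa>" using K graded(1) by simp

  \<comment> \<open>Sums over the two blocks are written with the indicator \<open>\<chi>\<close> as sums over all indices, and \<open>\<gamma>\<close> is the
    symmetric coefficient matrix of the quadratic part, so that all identities become forms in \<open>v\<close>.\<close>
  define \<chi> where "\<chi> i = (of_bool (i \<in> X) :: real)" for i
  define \<gamma> where "\<gamma> i j k = (if j = k then \<beta>2 i j k else \<beta>2 i j k / 2)" for i j k
  have X_sum: "(\<Sum>i\<in>X. f i) = (\<Sum>i\<in>N. \<chi> i * f i)" for f :: "nat \<Rightarrow> real"
    using XY fin by (auto simp: \<chi>_def intro!: sum.mono_neutral_cong_left)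
  have Y_sum: "(\<Sum>i\<in>Y. f i) = (\<Sum>i\<in>N. (1 - \<chi> i) * f i)" for f :: "nat \<Rightarrow> real"
    using XY fin by (auto simp: \<chi>_def intro!: sum.mono_neutral_cong_left)
  have eval_four: "eval_at n v 4 = 4" and eval_two: "eval_at n v 2 = 2" and eval_one: "eval_at n v 1 = 1" for v
    using eval_at_const[of n v 4] eval_at_const[of n v 2] eval_at_const[of n v 1] by (simp_all add: const_def)
  have eval_r1: "eval_at n v (r1 i) = (\<Sum>j\<in>N. \<beta>1 i j * v j)" for i v
    by (simp add: r1_def eval_at_sum eval_at_mult eval_at_const eval_at_var N_def)
  have eval_r2: "eval_at n v (r2 i) = (\<Sum>j\<in>N. \<Sum>k\<in>N. \<gamma> i j k * v j * v k)" if "i \<in> N" for i v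
  proof -
    have "eval_at n v (r2 i) = (\<Sum>j = 1..n. \<Sum>k = j..n. \<beta>2 i j k * v j * v k)"
      by (simp add: r2_def eval_at_sum eval_at_mult eval_at_const eval_at_var)
    also have "\<dots> = (\<Sum>j\<in>N. \<Sum>k\<in>N. \<gamma> i j k * v j * v k)"
      unfolding N_def
    proof (rule sum_upper_triangle)
      fix j k assume "1 \<le> j" "j < k" "k \<le> n"
      then show "\<gamma> i j k * v j * v k + \<gamma> i k j * v k * v j = \<beta>2 i j k * v j * v k"
        using sym[of i k j] that by (simp add: \<gamma>_def N_def)
    qed (simp add: \<gamma>_def)
    finally show ?thesis .
  qed
  have eval_\<kappa>: "eval_at n v \<kappa> = (\<Sum>i\<in>N. \<alpha> i * v i)" for v
    by (simp add: \<kappa>_def eval_at_sum eval_at_mult eval_at_const eval_at_var N_def)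
  have eval_s: "eval_at n v s = (\<Sum>i\<in>X. v i ^ 2)" and eval_w: "eval_at n v w = (\<Sum>i\<in>Y. v i ^ 2)" for v
    using XY(1) by (simp_all add: s_def w_def eval_squares)
  note evals = eval_at_add eval_at_diff eval_at_mult eval_at_const eval_F eval_r1 eval_\<kappa>
    eval_s eval_w eval_one eval_two eval_four c2
  have sub: "X \<subseteq> N" "Y \<subseteq> N" using XY by auto

  have linear: "2 * (\<Sum>i\<in>Y. v i * \<beta>0 i) - 4 * a\<^sup>2 * (\<Sum>i\<in>X. v i * \<beta>0 i)
      = (\<Sum>i\<in>N. \<alpha> i * v i) * (a ^ 4 - 1)" for v
    using arg_cong[OF graded(5), of "eval_at n v"] sub
    by (simp add: evals) (simp add: c_def eval_at_const)
  have quadratic_X: "(\<Sum>i\<in>X. v i * (\<Sum>j\<in>N. \<beta>1 i j * v j)) = 0" for v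
    using arg_cong[OF graded(2), of "eval_at n v"] sub by (simp add: evals) (simp add: eval_at_def)
  have quadratic_Y: "(\<Sum>i\<in>Y. v i * (\<Sum>j\<in>N. \<beta>1 i j * v j)) = 0" for v
    using arg_cong[OF graded(4), of "eval_at n v"] sub by (simp add: evals) (simp add: eval_at_def)
  have r2_sum: "(\<Sum>i\<in>I. v i * eval_at n v (r2 i)) = (\<Sum>i\<in>I. v i * (\<Sum>j\<in>N. \<Sum>k\<in>N. \<gamma> i j k * v j * v k))"
    if "I \<subseteq> N" for I v
    using that by (intro sum.cong refl) (auto simp: eval_r2)
  have cubic_X: "4 * (\<Sum>i\<in>X. v i * (\<Sum>j\<in>N. \<Sum>k\<in>N. \<gamma> i j k * v j * v k))
      = (\<Sum>i\<in>N. \<alpha> i * v i) * (\<Sum>i\<in>X. v i ^ 2)" for v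
    using arg_cong[OF graded(3), of "eval_at n v"] sub by (simp add: evals r2_sum)
  have cubic_Y: "4 * (\<Sum>i\<in>X. v i ^ 2) * (\<Sum>i\<in>X. v i * \<beta>0 i)
      + 2 * (\<Sum>i\<in>Y. v i * (\<Sum>j\<in>N. \<Sum>k\<in>N. \<gamma> i j k * v j * v k))
      = (\<Sum>i\<in>N. \<alpha> i * v i) * ((\<Sum>i\<in>Y. v i ^ 2) - a\<^sup>2 * (\<Sum>i\<in>X. v i ^ 2))" for v
    using arg_cong[OF graded(6), of "eval_at n v"] sub
    by (simp add: evals r2_sum) (simp add: c_def eval_at_const)

  have const_rel: "2 * (1 - \<chi> i) * \<beta>0 i - 4 * a\<^sup>2 * \<chi> i * \<beta>0 i - \<alpha> i * (a ^ 4 - 1) = 0" if "i \<in> N" for i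
  proof (rule vanishing_linear_form[OF fin(1) _ that])
    fix v
    show "(\<Sum>i\<in>N. (2 * (1 - \<chi> i) * \<beta>0 i - 4 * a\<^sup>2 * \<chi> i * \<beta>0 i - \<alpha> i * (a ^ 4 - 1)) * v i) = 0"
      using linear[of v] unfolding X_sum Y_sum sum_distrib_left sum_distrib_right
      by (simp add: algebra_simps sum_subtractf sum.distrib)
  qed
  \<comment> \<open>For \<open>i\<close> in the first block, the degree three identity at the unit vector \<open>e\<^sub>i\<close> reads
    \<open>4 \<beta>\<^sub>i\<^sub>0 = - a\<^sup>2 \<alpha>\<^sub>i\<close>, and the degree one identity reads \<open>- 4 a\<^sup>2 \<beta>\<^sub>i\<^sub>0 = (a\<^sup>4 - 1) \<alpha>\<^sub>i\<close>.
    Eliminating \<open>\<beta>\<^sub>i\<^sub>0\<close> leaves \<open>\<alpha>\<^sub>i = 0\<close>.\<close>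
  have X_zero: "\<alpha> i = 0 \<and> \<beta>0 i = 0" if "i \<in> X" for i
  proof -
    have i: "i \<in> N" "i \<notin> Y" using that XY by auto
    define e where "e l = (of_bool (l = i) :: real)" for l
    have e_X: "(\<Sum>l\<in>X. e l ^ 2) = 1" "(\<Sum>l\<in>X. e l * \<beta>0 l) = \<beta>0 i" "(\<Sum>l\<in>N. \<alpha> l * e l) = \<alpha> i"
      using sum_mult_unit_vector[OF fin(2) that, of e] sum_mult_unit_vector[OF fin(2) that, of \<beta>0]
        sum_mult_unit_vector[OF fin(1) i(1), of \<alpha>]
      by (simp_all add: e_def power2_eq_square mult.commute)
    have e_Y: "e l = 0" if "l \<in> Y" for l using that i by (auto simp: e_def)
    have "4 * \<beta>0 i = - (a\<^sup>2 * \<alpha> i)"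
      using cubic_Y[of e] by (simp add: e_X e_Y)
    moreover have "- (4 * a\<^sup>2 * \<beta>0 i) = \<alpha> i * (a ^ 4 - 1)"
      using const_rel[OF i(1)] that by (simp add: \<chi>_def)
    ultimately have "\<alpha> i = 0" by algebra
    then show ?thesis using \<open>4 * \<beta>0 i = - (a\<^sup>2 * \<alpha> i)\<close> by simp
  qed

  have \<gamma>_sym: "\<gamma> i j k = \<gamma> i k j" if "i \<in> N" "j \<in> N" "k \<in> N" for i j k
    using sym[of i j k] that by (simp add: \<gamma>_def N_def)
  have rel1: "\<chi> i * \<beta>1 i j + \<chi> j * \<beta>1 j i = 0" if "i \<in> N" "j \<in> N" for i j
  proof (rule vanishing_quadratic_form[OF fin(1) _ that])
    fix v
    show "(\<Sum>i\<in>N. \<Sum>j\<in>N. \<chi> i * \<beta>1 i j * v i * v j) = 0"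
      using quadratic_X[of v] unfolding X_sum by (simp add: sum_distrib_left mult_ac)
  qed
  have rel1': "(1 - \<chi> i) * \<beta>1 i j + (1 - \<chi> j) * \<beta>1 j i = 0" if "i \<in> N" "j \<in> N" for i j
  proof (rule vanishing_quadratic_form[OF fin(1) _ that])
    fix v
    show "(\<Sum>i\<in>N. \<Sum>j\<in>N. (1 - \<chi> i) * \<beta>1 i j * v i * v j) = 0"
      using quadratic_Y[of v] unfolding Y_sum by (simp add: sum_distrib_left mult_ac)
  qed
  have rel2: "4 * \<chi> i * \<gamma> i j k + 4 * \<chi> j * \<gamma> j i k + 4 * \<chi> k * \<gamma> k i j
      = \<alpha> i * (\<chi> j * of_bool (k = j)) + \<alpha> j * (\<chi> i * of_bool (k = i)) + \<alpha> k * (\<chi> i * of_bool (j = i))"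
    if "i \<in> N" "j \<in> N" "k \<in> N" for i j k
  proof (rule cubic_relations[OF fin(1) _ \<gamma>_sym that])
    fix v
    show "(\<Sum>i\<in>N. 4 * \<chi> i * v i * (\<Sum>j\<in>N. \<Sum>k\<in>N. \<gamma> i j k * v j * v k))
        = (\<Sum>i\<in>N. \<alpha> i * v i) * (\<Sum>j\<in>N. \<chi> j * (v j)\<^sup>2)"
      using cubic_X[of v] unfolding X_sum by (simp only: sum_distrib_left[of 4] mult.assoc)
  qed
  have rel2': "2 * (1 - \<chi> i) * \<gamma> i j k + 2 * (1 - \<chi> j) * \<gamma> j i k + 2 * (1 - \<chi> k) * \<gamma> k i j
      = \<alpha> i * ((1 - \<chi> j - a\<^sup>2 * \<chi> j) * of_bool (k = j)) + \<alpha> j * ((1 - \<chi> i - a\<^sup>2 * \<chi> i) * of_bool (k = i))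
        + \<alpha> k * ((1 - \<chi> i - a\<^sup>2 * \<chi> i) * of_bool (j = i))"
    if "i \<in> N" "j \<in> N" "k \<in> N" for i j k
  proof (rule cubic_relations[OF fin(1) _ \<gamma>_sym that])
    fix v
    \<comment> \<open>This removes the only term of \<open>cubic_Y\<close> that is not of the shape required by \<open>cubic_relations\<close>.\<close>
    have "(\<Sum>i\<in>X. v i * \<beta>0 i) = 0" using X_zero by simp
    moreover have "(\<Sum>j\<in>N. (1 - \<chi> j - a\<^sup>2 * \<chi> j) * (v j)\<^sup>2)
        = (\<Sum>j\<in>N. (1 - \<chi> j) * (v j)\<^sup>2) - a\<^sup>2 * (\<Sum>j\<in>N. \<chi> j * (v j)\<^sup>2)"
      by (simp add: sum_distrib_left mult.assoc left_diff_distrib sum_subtractf)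
    ultimately show "(\<Sum>i\<in>N. 2 * (1 - \<chi> i) * v i * (\<Sum>j\<in>N. \<Sum>k\<in>N. \<gamma> i j k * v j * v k))
        = (\<Sum>i\<in>N. \<alpha> i * v i) * (\<Sum>j\<in>N. (1 - \<chi> j - a\<^sup>2 * \<chi> j) * (v j)\<^sup>2)"
      using cubic_Y[of v] unfolding Y_sum
      by (simp only: mult_zero_right add_0_left X_sum sum_distrib_left[of 2] mult.assoc)
  qed

  have \<chi>: "\<chi> i = 1" "i \<in> N" if "i \<in> X" for i using that XY by (auto simp: \<chi>_def)
  have \<chi>': "\<chi> i = 0" "i \<in> N" "i \<notin> X" if "i \<in> Y" for i using that XY by (auto simp: \<chi>_def)
  have XY_neq: "i \<noteq> l" if "i \<in> X" "l \<in> Y" for i l using that XY by auto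

  \<comment> \<open>Each relation that is still open is now an instance of \<open>rel1\<close>, \<open>rel1'\<close>, \<open>rel2\<close>, \<open>rel2'\<close> or \<open>const_rel\<close>,
    depending on which of its indices coincide and on the blocks that they lie in.\<close>
  show ?thesis
    unfolding X_def[symmetric] Y_def[symmetric] N_def[symmetric]
  proof (intro exI[of _ \<alpha>] conjI ballI impI)
    show "K = (\<Sum>i\<in>N. const (\<alpha> i) * var i)"
      using K_linear by (simp add: \<kappa>_def)
    show "K = (\<Sum>l\<in>Y. const (\<alpha> l) * var l)"
      unfolding K_linear \<kappa>_def using sub X_zero XY fin
      by (intro sum.mono_neutral_right) (auto simp: const_def)
  next
    fix i assume "i \<in> X"
    then show "\<alpha> i = 0" "\<beta>0 i = 0" "4 * \<beta>2 i i i = \<alpha> i"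
      using X_zero rel2[of i i i] by (simp_all add: \<chi> \<gamma>_def)
  next
    fix i j k assume "i \<in> X" "j \<in> X" "k \<in> X" "distinct [i, j, k]"
    then show "\<beta>2 i j k + \<beta>2 j i k + \<beta>2 k i j = 0"
      using rel2[of i j k] by (auto simp add: \<chi> \<gamma>_def)
  next
    fix l r s assume "l \<in> Y" "r \<in> Y" "s \<in> Y" "distinct [l, r, s]"
    then show "\<beta>2 l r s + \<beta>2 r l s + \<beta>2 s l r = 0"
      using rel2'[of l r s] by (auto simp add: \<chi>' \<gamma>_def)
  next
    fix i j l assume "i \<in> X" "j \<in> X" "l \<in> Y" "i \<noteq> j"
    then show "\<beta>2 i j l + \<beta>2 j i l = 0"
      using rel2[of i j l] XY_neq[of i l] XY_neq[of j l] by (auto simp add: \<chi> \<chi>' \<gamma>_def)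
  next
    fix j l r assume "j \<in> X" "l \<in> Y" "r \<in> Y" "l \<noteq> r"
    then show "\<beta>2 l j r + \<beta>2 r j l = 0"
      using rel2'[of j l r] XY_neq[of j l] XY_neq[of j r] by (auto simp add: \<chi> \<chi>' \<gamma>_def)
  next
    fix i j assume ij: "i \<in> X" "j \<in> X" "i \<noteq> j"
    then show "4 * (\<beta>2 i j j + \<beta>2 j i j) = \<alpha> i"
      using rel2[of i j j] by (simp add: \<chi> \<gamma>_def)
    show "\<beta>1 i j + \<beta>1 j i = 0"
      using rel1[of i j] ij by (simp add: \<chi>)
  next
    fix l r assume lr: "l \<in> Y" "r \<in> Y" "l \<noteq> r"
    then show "2 * (\<beta>2 l r r + \<beta>2 r l r) = \<alpha> l"
      using rel2'[of l r r] by (simp add: \<chi>' \<gamma>_def)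
    show "\<beta>1 l r + \<beta>1 r l = 0"
      using rel1'[of l r] lr by (simp add: \<chi>')
  next
    fix i l assume "i \<in> X" "l \<in> Y"
    then show "2 * \<beta>2 l i i = - (a\<^sup>2) * \<alpha> l"
      using rel2'[of l i i] XY_neq[of i l] by (simp add: \<chi> \<chi>' \<gamma>_def)
  next
    fix l assume "l \<in> Y"
    then show "2 * \<beta>2 l l l = \<alpha> l" "\<beta>0 l = (a ^ 4 - 1) / 2 * \<alpha> l"
      using rel2'[of l l l] const_rel[of l] by (simp_all add: \<chi>' \<gamma>_def mult.commute)
  qed
qed

end
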